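(* Let $X, X_1,X_2,\ldots$ be i.i.d. random elements of $L_2(\mathcal{I})$, $\mathcal{I}=[0,1]$, and let $\varepsilon_1,\varepsilon_2,\ldots$ be i.i.d. normally distributed random variables with zero mean and variance $\sigma^2\in(0,\infty)$, independent of the $X_i$'s. For a functional $g:L_2(\mathcal{I})\to\mathbb{R}$ put $Y_i=g(X_i)+\varepsilon_i$. Fix $x\in L_2(\mathcal{I})$ and $\alpha\in(0,1]$. Suppose that $h=h(n)>0$ and that, for a constant $c_1>0$, as $n\to\infty$, $$nP(\|X-x\|\le c_1h)\to\infty\quad\text{and}\quad h^{2\alpha}P(\|X-x\|\le c_1h)\asymp n^{-1}.$$ For $C>0$ let $\mathcal{G}(C,x,\alpha)$ be the set of functionals $g$ such that $|g(x+\delta y)-g(x)|\le C\delta^\alpha$ for all $y\in L_2(\mathcal{I})$ with $\|y\|\le1$ and all $0\le\delta\le1$. Then, for any estimator $\tilde g(x)$ of $g(x)$ based on the data $(X_1,Y_1),\ldots,(X_n,Y_n)$, and for all sufficiently large $C>0$, there exists a constant $C_1>0$ such that $$\limsup_{n\to\infty}\ \sup_{g\in\mathcal{G}(C,x,\alpha)}P\{|\tilde g(x)-g(x)|>C_1h^\alpha\}>0 .$$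
   Context: $\|\cdot\|$ is the standard norm of $L_2(\mathcal{I})$. Functionals $g$ are real-valued and (Borel) measurable. An estimator $\tilde g(x)$ means a sequence (indexed by $n$) of measurable real-valued functions of the data $(X_1,Y_1),\ldots,(X_n,Y_n)$; $P$ is taken under the distribution of the data generated with the given $g$, the joint distribution of the $(X_i,\varepsilon_i)$ not depending on $g$. The notation $a_n\asymp b_n$ means that $a_n/b_n$ is bounded away from zero and infinity for all large $n$. *)

theory Defs
  imports "HOL-Probability.Probability" "HOL-Library.Landau_Symbols"
begin

section \<open>The Hilbert space of square integrable functions on the unit interval\<close>

abbreviation unit_lebesgue :: "real measure" where
  "unit_lebesgue \<equiv> lebesgue_on {0..1}"

definition square_integrable :: "(real \<Rightarrow> real) \<Rightarrow> bool" where
  "square_integrable f \<longleftrightarrow>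
     f \<in> borel_measurable unit_lebesgue \<and> integrable unit_lebesgue (\<lambda>t. (f t)\<^sup>2)"

definition L2_rel :: "(real \<Rightarrow> real) \<Rightarrow> (real \<Rightarrow> real) \<Rightarrow> bool" where
  "L2_rel f g \<longleftrightarrow>
     square_integrable f \<and> square_integrable g \<and> (AE t in unit_lebesgue. f t = g t)"

lemma square_integrable_mult:
  assumes "square_integrable f" "square_integrable g"
  shows "integrable unit_lebesgue (\<lambda>t. f t * g t)"
proof (rule Bochner_Integration.integrable_bound)
  show "integrable unit_lebesgue (\<lambda>t. (f t)\<^sup>2 + (g t)\<^sup>2)"
    using assms unfolding square_integrable_def by (intro Bochner_Integration.integrable_add) auto
  show "(\<lambda>t. f t * g t) \<in> borel_measurable unit_lebesgue"
    using assms unfolding square_integrable_def by auto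
  show "AE t in unit_lebesgue. norm (f t * g t) \<le> norm ((f t)\<^sup>2 + (g t)\<^sup>2)"
  proof (rule AE_I2)
    fix t
    have "0 \<le> (\<bar>f t\<bar> - \<bar>g t\<bar>)\<^sup>2" by simp
    then have "2 * (\<bar>f t\<bar> * \<bar>g t\<bar>) \<le> (f t)\<^sup>2 + (g t)\<^sup>2"
      by (simp add: power2_diff)
    moreover have "0 \<le> \<bar>f t\<bar> * \<bar>g t\<bar>" by simp
    ultimately show "norm (f t * g t) \<le> norm ((f t)\<^sup>2 + (g t)\<^sup>2)"
      unfolding real_norm_def abs_mult by linarith
  qed
qed

lemma square_integrable_zero: "square_integrable (\<lambda>_. 0)"
  unfolding square_integrable_def by simp

lemma square_integrable_add:
  assumes "square_integrable f" "square_integrable g"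
  shows "square_integrable (\<lambda>t. f t + g t)"
proof -
  have "integrable unit_lebesgue (\<lambda>t. (f t)\<^sup>2 + (g t)\<^sup>2 + 2 * (f t * g t))"
    using assms square_integrable_mult[OF assms] unfolding square_integrable_def
    by (intro Bochner_Integration.integrable_add integrable_mult_right) auto
  then show ?thesis
    using assms unfolding square_integrable_def by (auto simp: power2_sum mult.assoc)
qed

lemma square_integrable_scaleR:
  assumes "square_integrable f"
  shows "square_integrable (\<lambda>t. c * f t)"
  using assms unfolding square_integrable_def by (auto simp: power_mult_distrib)

lemma part_equivp_L2_rel: "part_equivp L2_rel"
proof (rule part_equivpI)
  show "\<exists>f. L2_rel f f"
    by (rule exI[of _ "\<lambda>_. 0"]) (simp add: L2_rel_def square_integrable_zero)
  show "symp L2_rel"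
    by (rule sympI) (auto simp: L2_rel_def eq_commute)
  show "transp L2_rel"
  proof (rule transpI)
    fix f g k assume "L2_rel f g" "L2_rel g k"
    moreover from this have "AE t in unit_lebesgue. f t = k t"
      unfolding L2_rel_def by (auto elim: eventually_elim2)
    ultimately show "L2_rel f k" by (simp add: L2_rel_def)
  qed
qed

quotient_type L2 = "real \<Rightarrow> real" / partial: L2_rel
  by (rule part_equivp_L2_rel)

instantiation L2 :: real_vector
begin

lift_definition zero_L2 :: L2 is "\<lambda>_. 0"
  by (simp add: L2_rel_def square_integrable_zero)

lift_definition plus_L2 :: "L2 \<Rightarrow> L2 \<Rightarrow> L2" is "\<lambda>f g t. f t + g t"
  by (auto simp: L2_rel_def square_integrable_add elim: eventually_elim2)

lift_definition scaleR_L2 :: "real \<Rightarrow> L2 \<Rightarrow> L2" is "\<lambda>c f t. c * f t"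
  by (auto simp: L2_rel_def square_integrable_scaleR)

definition uminus_L2 :: "L2 \<Rightarrow> L2" where
  "uminus_L2 x = (-1) *\<^sub>R x"

definition minus_L2 :: "L2 \<Rightarrow> L2 \<Rightarrow> L2" where
  "minus_L2 x y = x + (- y)"

instance
proof
  fix x y z :: L2 and a b :: real
  show "x + y + z = x + (y + z)"
    by transfer (auto simp: L2_rel_def square_integrable_add add.assoc)
  show "x + y = y + x"
    by transfer (auto simp: L2_rel_def square_integrable_add add.commute)
  show "0 + x = x"
    by transfer (auto simp: L2_rel_def)
  show "- x + x = 0"
    unfolding uminus_L2_def by transfer (auto simp: L2_rel_def square_integrable_zero)
  show "x - y = x + - y"
    by (rule minus_L2_def)
  show "a *\<^sub>R (x + y) = a *\<^sub>R x + a *\<^sub>R y"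
    by transfer (auto simp: L2_rel_def square_integrable_add square_integrable_scaleR
        distrib_left)
  show "(a + b) *\<^sub>R x = a *\<^sub>R x + b *\<^sub>R x"
    by transfer (auto simp: L2_rel_def square_integrable_add square_integrable_scaleR
        distrib_right)
  show "a *\<^sub>R b *\<^sub>R x = (a * b) *\<^sub>R x"
    by transfer (auto simp: L2_rel_def square_integrable_scaleR mult.assoc)
  show "1 *\<^sub>R x = x"
    by transfer (auto simp: L2_rel_def)
qed

end

instantiation L2 :: real_inner
begin

lift_definition inner_L2 :: "L2 \<Rightarrow> L2 \<Rightarrow> real" is
  "\<lambda>f g. \<integral>t. f t * g t \<partial>unit_lebesgue"
proof -
  fix f f' g g' assume "L2_rel f f'" "L2_rel g g'"
  then have "AE t in unit_lebesgue. f t = f' t" "AE t in unit_lebesgue. g t = g' t"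
    and "square_integrable f" "square_integrable f'" "square_integrable g" "square_integrable g'"
    by (auto simp: L2_rel_def)
  then show "(\<integral>t. f t * g t \<partial>unit_lebesgue) = (\<integral>t. f' t * g' t \<partial>unit_lebesgue)"
    by (intro integral_cong_AE borel_measurable_integrable square_integrable_mult)
       (auto elim: eventually_elim2)
qed

definition norm_L2 :: "L2 \<Rightarrow> real" where
  "norm_L2 x = sqrt (inner x x)"

definition sgn_L2 :: "L2 \<Rightarrow> L2" where
  "sgn_L2 x = x /\<^sub>R norm x"

definition dist_L2 :: "L2 \<Rightarrow> L2 \<Rightarrow> real" where
  "dist_L2 x y = norm (x - y)"

definition uniformity_L2 :: "(L2 \<times> L2) filter" where
  "uniformity_L2 = (INF e\<in>{0<..}. principal {(x, y). dist x y < e})"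

definition open_L2 :: "L2 set \<Rightarrow> bool" where
  "open_L2 U \<longleftrightarrow> (\<forall>x\<in>U. \<forall>\<^sub>F (x', y) in uniformity. x' = x \<longrightarrow> y \<in> U)"

instance
proof
  fix x y z :: L2 and r :: real and U :: "L2 set"
  show "dist x y = norm (x - y)" by (rule dist_L2_def)
  show "sgn x = x /\<^sub>R norm x" by (rule sgn_L2_def)
  show "(uniformity :: (L2 \<times> L2) filter) = (INF e\<in>{0<..}. principal {(x, y). dist x y < e})"
    by (rule uniformity_L2_def)
  show "open U \<longleftrightarrow> (\<forall>x\<in>U. \<forall>\<^sub>F (x', y) in uniformity. x' = x \<longrightarrow> y \<in> U)"
    by (rule open_L2_def)
  show "norm x = sqrt (inner x x)" by (rule norm_L2_def)
  show "inner x y = inner y x"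
    by transfer (simp add: mult.commute)
  show "inner (x + y) z = inner x z + inner y z"
    by transfer (simp add: L2_rel_def distrib_right square_integrable_mult)
  show "inner (r *\<^sub>R x) y = r * inner x y"
    by transfer (simp add: L2_rel_def mult.assoc)
  show "0 \<le> inner x x"
    by transfer simp
  show "inner x x = 0 \<longleftrightarrow> x = 0"
  proof transfer
    fix f assume "L2_rel f f"
    then have f: "square_integrable f" by (simp add: L2_rel_def)
    have "(\<integral>t. f t * f t \<partial>unit_lebesgue) = 0 \<longleftrightarrow> (AE t in unit_lebesgue. f t * f t = 0)"
      by (intro integral_nonneg_eq_0_iff_AE square_integrable_mult f AE_I2) simp
    then show "(\<integral>t. f t * f t \<partial>unit_lebesgue) = 0 \<longleftrightarrow> L2_rel f (\<lambda>_. 0)"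
      using f by (simp add: L2_rel_def square_integrable_zero)
  qed
qed

end

section \<open>Nonparametric regression on functional data\<close>

text \<open>
  Independence of two random variables with different codomains, phrased through the
  generated sigma-algebras because \<^const>\<open>prob_space.indep_var\<close> forces a common codomain type.
\<close>

definition indep_rvs :: "'a measure \<Rightarrow> 'b measure \<Rightarrow> ('a \<Rightarrow> 'b) \<Rightarrow> 'c measure \<Rightarrow> ('a \<Rightarrow> 'c) \<Rightarrow> bool" where
  "indep_rvs M N U N' V \<longleftrightarrow>
     U \<in> measurable M N \<and> V \<in> measurable M N' \<and>
     prob_space.indep_set M
       (sets (vimage_algebra (space M) U N)) (sets (vimage_algebra (space M) V N'))"

definition holder_functionals :: "real \<Rightarrow> L2 \<Rightarrow> real \<Rightarrow> (L2 \<Rightarrow> real) set" where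
  "holder_functionals C x \<alpha> =
     {g \<in> borel_measurable borel.
        \<forall>y \<delta>. norm y \<le> 1 \<longrightarrow> 0 \<le> \<delta> \<longrightarrow> \<delta> \<le> 1 \<longrightarrow>
          \<bar>g (x + \<delta> *\<^sub>R y) - g x\<bar> \<le> C * \<delta> powr \<alpha>}"

definition regression_data ::
  "(nat \<Rightarrow> 'a \<Rightarrow> L2) \<Rightarrow> (nat \<Rightarrow> 'a \<Rightarrow> real) \<Rightarrow> (L2 \<Rightarrow> real) \<Rightarrow> nat \<Rightarrow> 'a \<Rightarrow> nat \<Rightarrow> L2 \<times> real" where
  "regression_data X \<epsilon> g n \<omega> = (\<lambda>i\<in>{1..n}. (X i \<omega>, g (X i \<omega>) + \<epsilon> i \<omega>))"

definition estimator :: "(nat \<Rightarrow> (nat \<Rightarrow> L2 \<times> real) \<Rightarrow> real) \<Rightarrow> bool" where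
  "estimator T \<longleftrightarrow> (\<forall>n. T n \<in> borel_measurable (Pi\<^sub>M {1..n} (\<lambda>_. borel \<Otimes>\<^sub>M borel)))"

end

theory Submission
  imports Defs
begin

text \<open>
  The proof is a two-point argument. The class contains the zero functional and, as soon as
  \<open>C \<ge> c\<^sub>1 powr (- \<alpha>)\<close>, the functional \<open>s\<close> that equals \<open>h powr \<alpha>\<close> on the ball of radius \<open>c\<^sub>1 h\<close>
  about \<open>x\<close> and vanishes elsewhere: the class restricts increments from the centre \<open>x\<close> only, so the
  jump at the sphere is harmless. At \<open>x\<close> the two functionals differ by \<open>h powr \<alpha>\<close>, so an estimator
  that errs by at most a quarter of this under either of them distinguishes the two data laws.
  
  It cannot distinguish them well. Conditionally on the design, replacing \<open>0\<close> by \<open>s\<close> shifts the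
  Gaussian errors, and the law of the data under \<open>s\<close> has a density with respect to the law under \<open>0\<close>.
  With \<open>q = P(\<parallel>X - x\<parallel> \<le> c\<^sub>1 h)\<close>, the second moment of this density is
  \<open>(1 + q (exp (h powr (2 \<alpha>) / \<sigma>\<^sup>2) - 1)) ^ n\<close>, and the conditions on \<open>h\<close> keep it bounded:
  \<open>n q h powr (2 \<alpha>)\<close> is bounded by the second one, and since the first one makes \<open>n q \<ge> 1\<close> eventually,
  \<open>h powr (2 \<alpha>)\<close> is bounded too. By the Cauchy--Schwarz inequality an event of probability close to
  one under \<open>s\<close> has probability bounded away from zero under \<open>0\<close>; the event that the estimate is
  near \<open>h powr \<alpha>\<close> then forces an error under one of the two functionals.
  
  The bound on probabilities is \<open>regression_second_moment_bound\<close>, stated for product measures;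
  \<open>distr_regression_data\<close> transfers it to the given random variables, and
  \<open>minimax_lower_bound_finite_sample\<close> is the resulting inequality for each sample size.
\<close>

section \<open>Densities and images of finite product measures\<close>

lemma product_prob_space_PiM_density:
  assumes "finite I" and "product_prob_space M" and "product_prob_space (\<lambda>i. density (M i) (f i))"
    and [measurable]: "\<And>i. i \<in> I \<Longrightarrow> f i \<in> borel_measurable (M i)"
  shows "density (PiM I M) (\<lambda>x. \<Prod>i\<in>I. f i (x i)) = PiM I (\<lambda>i. density (M i) (f i))"
proof -
  interpret M: product_prob_space M by fact
  interpret D: product_prob_space "\<lambda>i. density (M i) (f i)" by fact
  show ?thesis
  proof (rule D.PiM_eqI)
    fix A assume "\<And>i. i \<in> I \<Longrightarrow> A i \<in> sets (density (M i) (f i))"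
    then have A[measurable]: "\<And>i. i \<in> I \<Longrightarrow> A i \<in> sets (M i)" by simp
    have ind: "indicator (Pi\<^sub>E I A) x = (\<Prod>i\<in>I. indicator (A i) (x i) :: ennreal)"
      if "x \<in> space (PiM I M)" for x
    proof (cases "x \<in> Pi\<^sub>E I A")
      case False
      with that obtain i where "i \<in> I" "x i \<notin> A i"
        by (auto simp: space_PiM PiE_def Pi_def)
      with False assms(1) show ?thesis
        by (auto intro!: prod_zero[symmetric] bexI[of _ i])
    qed (auto simp: PiE_def Pi_def)
    have "emeasure (density (PiM I M) (\<lambda>x. \<Prod>i\<in>I. f i (x i))) (Pi\<^sub>E I A)
        = (\<integral>\<^sup>+x. (\<Prod>i\<in>I. f i (x i)) * indicator (Pi\<^sub>E I A) x \<partial>PiM I M)"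
      using assms(1) A by (subst emeasure_density) (auto intro!: sets_PiM_I_finite)
    also have "\<dots> = (\<integral>\<^sup>+x. (\<Prod>i\<in>I. f i (x i) * indicator (A i) (x i)) \<partial>PiM I M)"
      by (intro nn_integral_cong) (simp add: ind prod.distrib)
    also have "\<dots> = (\<Prod>i\<in>I. \<integral>\<^sup>+y. f i y * indicator (A i) y \<partial>M i)"
      by (rule M.product_nn_integral_prod) (use assms(1) in auto)
    also have "\<dots> = (\<Prod>i\<in>I. emeasure (density (M i) (f i)) (A i))"
      by (intro prod.cong) (auto simp: emeasure_density)
    finally show "emeasure (density (PiM I M) (\<lambda>x. \<Prod>i\<in>I. f i (x i))) (Pi\<^sub>E I A)
        = (\<Prod>i\<in>I. emeasure (density (M i) (f i)) (A i))" .
  qed (use assms(1) in \<open>auto intro!: sets_PiM_cong\<close>)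
qed

lemma product_prob_space_PiM_distr:
  assumes "finite I" and "product_prob_space M" and "product_prob_space (\<lambda>i. distr (M i) (N i) (f i))"
    and f[measurable]: "\<And>i. i \<in> I \<Longrightarrow> f i \<in> measurable (M i) (N i)"
  shows "distr (PiM I M) (PiM I N) (\<lambda>x. \<lambda>i\<in>I. f i (x i)) = PiM I (\<lambda>i. distr (M i) (N i) (f i))"
proof -
  interpret M: product_prob_space M by fact
  interpret D: product_prob_space "\<lambda>i. distr (M i) (N i) (f i)" by fact
  have F: "(\<lambda>x. \<lambda>i\<in>I. f i (x i)) \<in> measurable (PiM I M) (PiM I N)"
    by (intro measurable_restrict) measurable
  show ?thesis
  proof (rule D.PiM_eqI)
    fix A assume "\<And>i. i \<in> I \<Longrightarrow> A i \<in> sets (distr (M i) (N i) (f i))"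
    then have A[measurable]: "\<And>i. i \<in> I \<Longrightarrow> A i \<in> sets (N i)" by simp
    have "emeasure (distr (PiM I M) (PiM I N) (\<lambda>x. \<lambda>i\<in>I. f i (x i))) (Pi\<^sub>E I A)
        = emeasure (PiM I M) ((\<lambda>x. \<lambda>i\<in>I. f i (x i)) -` Pi\<^sub>E I A \<inter> space (PiM I M))"
      using assms(1) A by (intro emeasure_distr F sets_PiM_I_finite) auto
    also have "(\<lambda>x. \<lambda>i\<in>I. f i (x i)) -` Pi\<^sub>E I A \<inter> space (PiM I M)
        = Pi\<^sub>E I (\<lambda>i. f i -` A i \<inter> space (M i))"
      by (auto simp: space_PiM PiE_def Pi_def)
    also have "emeasure (PiM I M) \<dots> = (\<Prod>i\<in>I. emeasure (M i) (f i -` A i \<inter> space (M i)))"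
      using assms(1) by (intro M.emeasure_PiM) auto
    also have "\<dots> = (\<Prod>i\<in>I. emeasure (distr (M i) (N i) (f i)) (A i))"
      by (intro prod.cong) (auto simp: emeasure_distr)
    finally show "emeasure (distr (PiM I M) (PiM I N) (\<lambda>x. \<lambda>i\<in>I. f i (x i))) (Pi\<^sub>E I A)
        = (\<Prod>i\<in>I. emeasure (distr (M i) (N i) (f i)) (A i))" .
  qed (use assms(1) in \<open>auto intro!: sets_PiM_cong\<close>)
qed

section \<open>Shifts of Gaussian noise\<close>

abbreviation gauss :: "real \<Rightarrow> real measure" where
  "gauss \<sigma> \<equiv> density lborel (normal_density 0 \<sigma>)"

text \<open>
  The likelihood ratio of the normal law with mean \<open>s\<close> against the centred one, both with standard
  deviation \<open>\<sigma>\<close>.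
\<close>

definition gauss_lr :: "real \<Rightarrow> real \<Rightarrow> real \<Rightarrow> real" where
  "gauss_lr \<sigma> s u = exp ((2 * s * u - s\<^sup>2) / (2 * \<sigma>\<^sup>2))"

lemma measurable_gauss_lr [measurable (raw)]:
  assumes [measurable]: "f \<in> borel_measurable M" "g \<in> borel_measurable M"
  shows "(\<lambda>z. gauss_lr \<sigma> (f z) (g z)) \<in> borel_measurable M"
  unfolding gauss_lr_def by measurable

lemma gauss_lr_pos: "gauss_lr \<sigma> s u > 0"
  by (simp add: gauss_lr_def)

text \<open>
  Both identities come from completing the square. The second one makes the second moment of the
  likelihood ratio the total mass of another normal law, centred at \<open>2 * s\<close>.
\<close>

lemma normal_density_gauss_lr:
  assumes "\<sigma> > 0"
  shows "normal_density 0 \<sigma> u * gauss_lr \<sigma> s u = normal_density 0 \<sigma> (u - s)"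
    and "normal_density 0 \<sigma> u * (gauss_lr \<sigma> s u)\<^sup>2
           = exp (s\<^sup>2 / \<sigma>\<^sup>2) * normal_density (2 * s) \<sigma> u"
  using assms
  by (simp_all add: normal_density_def gauss_lr_def field_simps power2_eq_square
      flip: exp_add exp_double)

lemma distr_gauss_shift:
  assumes "\<sigma> > 0"
  shows "distr (gauss \<sigma>) borel ((+) s) = density (gauss \<sigma>) (gauss_lr \<sigma> s)"
proof -
  have "distr (gauss \<sigma>) borel ((+) s)
      = distr (density lborel (\<lambda>u. ennreal (normal_density 0 \<sigma> (s + u - s)))) borel ((+) s)"
    by simp
  also have "\<dots> = density (distr lborel borel ((+) s)) (\<lambda>u. ennreal (normal_density 0 \<sigma> (u - s)))"
    by (subst density_distr) simp_all
  also have "\<dots> = density lborel (\<lambda>u. ennreal (normal_density 0 \<sigma> (u - s)))"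
    by (simp only: lborel_distr_plus)
  also have "\<dots> = density (gauss \<sigma>) (gauss_lr \<sigma> s)"
    using assms
    by (subst density_density_eq)
       (auto simp: ennreal_mult'[symmetric] gauss_lr_pos less_imp_le normal_density_gauss_lr)
  finally show ?thesis .
qed

lemma nn_integral_gauss_lr_sq:
  assumes "\<sigma> > 0"
  shows "(\<integral>\<^sup>+u. (ennreal (gauss_lr \<sigma> s u))\<^sup>2 \<partial>gauss \<sigma>) = ennreal (exp (s\<^sup>2 / \<sigma>\<^sup>2))"
proof -
  interpret N: prob_space "density lborel (normal_density (2 * s) \<sigma>)"
    by (rule prob_space_normal_density[OF assms])
  have "(\<integral>\<^sup>+u. (ennreal (gauss_lr \<sigma> s u))\<^sup>2 \<partial>gauss \<sigma>)
      = (\<integral>\<^sup>+u. ennreal (normal_density 0 \<sigma> u * (gauss_lr \<sigma> s u)\<^sup>2) \<partial>lborel)"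
    by (subst nn_integral_density)
       (auto simp: ennreal_mult ennreal_power gauss_lr_pos less_imp_le)
  also have "\<dots> = (\<integral>\<^sup>+u. ennreal (exp (s\<^sup>2 / \<sigma>\<^sup>2)) * ennreal (normal_density (2 * s) \<sigma> u) \<partial>lborel)"
    using assms by (simp add: normal_density_gauss_lr ennreal_mult)
  also have "\<dots> = ennreal (exp (s\<^sup>2 / \<sigma>\<^sup>2)) * emeasure (density lborel (normal_density (2 * s) \<sigma>)) UNIV"
    by (subst nn_integral_cmult) (auto simp: emeasure_density)
  also have "\<dots> = ennreal (exp (s\<^sup>2 / \<sigma>\<^sup>2))"
    using N.emeasure_space_1 by simp
  finally show ?thesis .
qed

text \<open>
  The coordinates are shifted by different amounts, which is why the image and the density of a
  product measure are needed above with coordinate-dependent maps: both sides are integrals over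
  the product of the shifted normal laws.
\<close>

lemma nn_integral_PiM_gauss_shift:
  assumes "\<sigma> > 0" and "finite I" and [measurable]: "F \<in> borel_measurable (PiM I (\<lambda>_. borel))"
  shows "(\<integral>\<^sup>+e. F (\<lambda>i\<in>I. s i + e i) \<partial>PiM I (\<lambda>_. gauss \<sigma>))
       = (\<integral>\<^sup>+e. (\<Prod>i\<in>I. ennreal (gauss_lr \<sigma> (s i) (e i))) * F e \<partial>PiM I (\<lambda>_. gauss \<sigma>))"
proof -
  have G: "prob_space (gauss \<sigma>)"
    by (rule prob_space_normal_density[OF assms(1)])
  have D: "prob_space (distr (gauss \<sigma>) borel ((+) (s i)))" for i
    by (intro prob_space.prob_space_distr G) simp
  have S: "(\<lambda>e. \<lambda>i\<in>I. s i + e i) \<in> measurable (PiM I (\<lambda>_. gauss \<sigma>)) (PiM I (\<lambda>_. borel))"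
    by (intro measurable_restrict) measurable
  have sets: "sets (PiM I (\<lambda>_. gauss \<sigma>)) = sets (PiM I (\<lambda>_. borel))"
    by (intro sets_PiM_cong) auto
  have "(\<integral>\<^sup>+e. F (\<lambda>i\<in>I. s i + e i) \<partial>PiM I (\<lambda>_. gauss \<sigma>))
      = (\<integral>\<^sup>+y. F y \<partial>distr (PiM I (\<lambda>_. gauss \<sigma>)) (PiM I (\<lambda>_. borel)) (\<lambda>e. \<lambda>i\<in>I. s i + e i))"
    by (subst nn_integral_distr[OF S]) simp_all
  also have "distr (PiM I (\<lambda>_. gauss \<sigma>)) (PiM I (\<lambda>_. borel)) (\<lambda>e. \<lambda>i\<in>I. s i + e i)
      = PiM I (\<lambda>i. distr (gauss \<sigma>) borel ((+) (s i)))"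
    by (rule product_prob_space_PiM_distr[OF assms(2), of _ _ "\<lambda>i. (+) (s i)"])
       (auto intro!: product_prob_spaceI G D)
  also have "\<dots> = density (PiM I (\<lambda>_. gauss \<sigma>)) (\<lambda>e. \<Prod>i\<in>I. ennreal (gauss_lr \<sigma> (s i) (e i)))"
    using assms(2) D unfolding distr_gauss_shift[OF assms(1)]
    by (intro product_prob_space_PiM_density[symmetric] product_prob_spaceI G) auto
  also have "(\<integral>\<^sup>+y. F y \<partial>\<dots>)
      = (\<integral>\<^sup>+e. (\<Prod>i\<in>I. ennreal (gauss_lr \<sigma> (s i) (e i))) * F e \<partial>PiM I (\<lambda>_. gauss \<sigma>))"
    by (intro nn_integral_density) (auto simp: measurable_cong_sets[OF sets refl])
  finally show ?thesis .
qed

section \<open>Comparing the laws of the data\<close>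

lemma data_measurable:
  assumes [measurable]: "g \<in> borel_measurable N"
  shows "(\<lambda>(x, e). \<lambda>i\<in>I. (x i, g (x i) + e i))
    \<in> measurable (PiM I (\<lambda>_. N) \<Otimes>\<^sub>M PiM I (\<lambda>_. borel)) (PiM I (\<lambda>_. N \<Otimes>\<^sub>M (borel :: real measure)))"
  unfolding case_prod_beta by (intro measurable_restrict) measurable

text \<open>
  For a fixed design \<open>x\<close>, the regression function \<open>s\<close> shifts the noise by \<open>s (x i)\<close>, so the law of
  the data under \<open>s\<close> has density \<open>L\<close>, a product of likelihood ratios, with respect to the law under
  \<open>0\<close>. The Cauchy--Schwarz inequality applied to \<open>L\<close> and the indicator of the event gives the
  bound, and the second moment of \<open>L\<close> factorises because the pairs \<open>(x i, e i)\<close> are independent.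
\<close>

lemma regression_second_moment_bound:
  fixes \<mu> :: "'b measure" and s :: "'b \<Rightarrow> real" and I :: "'i set" and \<sigma> :: real
  defines "K \<equiv> PiM I (\<lambda>_. \<mu>) \<Otimes>\<^sub>M PiM I (\<lambda>_. gauss \<sigma>)"
  assumes "prob_space \<mu>" and s[measurable]: "s \<in> borel_measurable \<mu>"
    and "\<sigma> > 0" and "finite I" and A: "A \<in> sets (PiM I (\<lambda>_. \<mu> \<Otimes>\<^sub>M borel))"
  shows "(emeasure (distr (K) (PiM I (\<lambda>_. \<mu> \<Otimes>\<^sub>M borel)) (\<lambda>(x, e). \<lambda>i\<in>I. (x i, s (x i) + e i))) A)\<^sup>2
       \<le> (\<integral>\<^sup>+z. ennreal (exp ((s z)\<^sup>2 / \<sigma>\<^sup>2)) \<partial>\<mu>) ^ card I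
         * emeasure (distr (K) (PiM I (\<lambda>_. \<mu> \<Otimes>\<^sub>M borel)) (\<lambda>(x, e). \<lambda>i\<in>I. (x i, 0 + e i))) A"
proof -
  note [measurable] = A
  let ?N = "PiM I (\<lambda>_. gauss \<sigma>)" and ?M = "PiM I (\<lambda>_. \<mu>)"
  let ?P = "PiM I (\<lambda>_. \<mu> \<Otimes>\<^sub>M (borel :: real measure))"
  interpret N: prob_space ?N by (intro prob_space_PiM prob_space_normal_density[OF assms(4)])
  interpret G: product_prob_space "\<lambda>_. gauss \<sigma>"
    by (intro product_prob_spaceI prob_space_normal_density[OF assms(4)])
  interpret U: product_prob_space "\<lambda>_. \<mu>"
    by (intro product_prob_spaceI assms(2))
  have sets_N [measurable_cong]: "sets ?N = sets (PiM I (\<lambda>_. borel))"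
    by (intro sets_PiM_cong) auto
  define D where "D = (\<lambda>(x :: 'i \<Rightarrow> 'b, e :: 'i \<Rightarrow> real). \<lambda>i\<in>I. (x i, e i))"
  define L where "L = (\<lambda>(x, e). \<Prod>i\<in>I. ennreal (gauss_lr \<sigma> (s (x i)) (e i)))"
  have D[measurable]: "D \<in> measurable (?M \<Otimes>\<^sub>M PiM I (\<lambda>_. borel)) ?P"
    using data_measurable[of "\<lambda>_. 0" \<mu> I] by (simp add: D_def)
  have L[measurable]: "L \<in> borel_measurable (?M \<Otimes>\<^sub>M ?N)"
    unfolding L_def case_prod_beta by measurable
  have data: "(\<lambda>(x, e). \<lambda>i\<in>I. (x i, g (x i) + e i)) \<in> measurable (?M \<Otimes>\<^sub>M ?N) ?P"
    if "g \<in> borel_measurable \<mu>" for g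
    using data_measurable[OF that, of I] by (simp cong: measurable_cong_sets sets_pair_measure_cong add: sets_N)
  have law: "emeasure (distr (K) ?P (\<lambda>(x, e). \<lambda>i\<in>I. (x i, g (x i) + e i))) A
      = (\<integral>\<^sup>+z. indicator A ((\<lambda>(x, e). \<lambda>i\<in>I. (x i, g (x i) + e i)) z) \<partial>(?M \<Otimes>\<^sub>M ?N))"
    if g: "g \<in> borel_measurable \<mu>" for g
  proof -
    have "emeasure (distr (K) ?P (\<lambda>(x, e). \<lambda>i\<in>I. (x i, g (x i) + e i))) A
        = (\<integral>\<^sup>+y. indicator A y \<partial>distr (K) ?P (\<lambda>(x, e). \<lambda>i\<in>I. (x i, g (x i) + e i)))"
      by simp
    also have "\<dots> = (\<integral>\<^sup>+z. indicator A ((\<lambda>(x, e). \<lambda>i\<in>I. (x i, g (x i) + e i)) z) \<partial>(?M \<Otimes>\<^sub>M ?N))"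
      unfolding K_def by (rule nn_integral_distr[OF data[OF g]]) simp
    finally show ?thesis .
  qed
  have "(\<integral>\<^sup>+z. indicator A ((\<lambda>(x, e). \<lambda>i\<in>I. (x i, s (x i) + e i)) z) \<partial>(?M \<Otimes>\<^sub>M ?N))
      = (\<integral>\<^sup>+x. \<integral>\<^sup>+e. indicator A (\<lambda>i\<in>I. (x i, s (x i) + e i)) \<partial>?N \<partial>?M)"
    using data[OF s] by (subst N.nn_integral_fst[symmetric]) (auto intro: measurable_compose)
  also have "\<dots> = (\<integral>\<^sup>+x. \<integral>\<^sup>+e. indicator A (D (x, \<lambda>i\<in>I. s (x i) + e i)) \<partial>?N \<partial>?M)"
    by (simp add: D_def cong: restrict_cong)
  also have "\<dots> = (\<integral>\<^sup>+x. \<integral>\<^sup>+e. L (x, e) * indicator A (D (x, e)) \<partial>?N \<partial>?M)"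
  proof (rule nn_integral_cong)
    fix x assume [measurable]: "x \<in> space ?M"
    show "(\<integral>\<^sup>+e. indicator A (D (x, \<lambda>i\<in>I. s (x i) + e i)) \<partial>?N)
        = (\<integral>\<^sup>+e. L (x, e) * indicator A (D (x, e)) \<partial>?N)"
      unfolding L_def prod.case
      by (rule nn_integral_PiM_gauss_shift[OF assms(4,5), of "\<lambda>e. indicator A (D (x, e))"]) measurable
  qed
  also have "\<dots> = (\<integral>\<^sup>+z. L z * indicator A (D z) \<partial>(?M \<Otimes>\<^sub>M ?N))"
    by (rule N.nn_integral_fst) measurable
  finally have change: "(\<integral>\<^sup>+z. indicator A ((\<lambda>(x, e). \<lambda>i\<in>I. (x i, s (x i) + e i)) z) \<partial>(?M \<Otimes>\<^sub>M ?N))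
      = (\<integral>\<^sup>+z. L z * indicator A (D z) \<partial>(?M \<Otimes>\<^sub>M ?N))" .
  have "(\<integral>\<^sup>+z. (L z)\<^sup>2 \<partial>(?M \<Otimes>\<^sub>M ?N)) = (\<integral>\<^sup>+x. \<integral>\<^sup>+e. (L (x, e))\<^sup>2 \<partial>?N \<partial>?M)"
    by (rule N.nn_integral_fst[symmetric]) measurable
  also have "\<dots> = (\<integral>\<^sup>+x. (\<Prod>i\<in>I. ennreal (exp ((s (x i))\<^sup>2 / \<sigma>\<^sup>2))) \<partial>?M)"
  proof (rule nn_integral_cong)
    fix x
    have "(\<integral>\<^sup>+e. (L (x, e))\<^sup>2 \<partial>?N)
        = (\<integral>\<^sup>+e. (\<Prod>i\<in>I. (ennreal (gauss_lr \<sigma> (s (x i)) (e i)))\<^sup>2) \<partial>?N)"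
      by (simp add: L_def prod_power_distrib)
    also have "\<dots> = (\<Prod>i\<in>I. \<integral>\<^sup>+u. (ennreal (gauss_lr \<sigma> (s (x i)) u))\<^sup>2 \<partial>gauss \<sigma>)"
      using assms(5) by (intro G.product_nn_integral_prod) auto
    finally show "(\<integral>\<^sup>+e. (L (x, e))\<^sup>2 \<partial>?N) = (\<Prod>i\<in>I. ennreal (exp ((s (x i))\<^sup>2 / \<sigma>\<^sup>2)))"
      by (simp add: nn_integral_gauss_lr_sq[OF assms(4)])
  qed
  also have "\<dots> = (\<Prod>i\<in>I. \<integral>\<^sup>+z. ennreal (exp ((s z)\<^sup>2 / \<sigma>\<^sup>2)) \<partial>\<mu>)"
    using assms(5) by (intro U.product_nn_integral_prod) auto
  finally have moment: "(\<integral>\<^sup>+z. (L z)\<^sup>2 \<partial>(?M \<Otimes>\<^sub>M ?N))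
      = (\<integral>\<^sup>+z. ennreal (exp ((s z)\<^sup>2 / \<sigma>\<^sup>2)) \<partial>\<mu>) ^ card I"
    by simp
  have "(\<integral>\<^sup>+z. L z * indicator A (D z) \<partial>(?M \<Otimes>\<^sub>M ?N))\<^sup>2
      \<le> (\<integral>\<^sup>+z. (L z)\<^sup>2 \<partial>(?M \<Otimes>\<^sub>M ?N)) * (\<integral>\<^sup>+z. (indicator A (D z))\<^sup>2 \<partial>(?M \<Otimes>\<^sub>M ?N))"
    by (rule Cauchy_Schwarz_nn_integral) measurable
  also have "(\<integral>\<^sup>+z. (indicator A (D z) :: ennreal)\<^sup>2 \<partial>(?M \<Otimes>\<^sub>M ?N))
      = (\<integral>\<^sup>+z. indicator A ((\<lambda>(x, e). \<lambda>i\<in>I. (x i, 0 + e i)) z) \<partial>(?M \<Otimes>\<^sub>M ?N))"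
    by (intro nn_integral_cong) (auto simp: D_def indicator_def)
  finally show ?thesis
    using law[OF s] law[of "\<lambda>_. 0"] by (simp add: change moment)
qed

section \<open>The regression model\<close>

text \<open>
  Independence is assumed for the infinite sequences, whereas the data use finitely many coordinates;
  the maps \<open>f\<close> and \<open>g\<close> serve to truncate.
\<close>

lemma indep_rvs_distr_pair:
  assumes "prob_space M" and indep: "indep_rvs M N U N' V"
    and [measurable]: "f \<in> measurable N K" "g \<in> measurable N' K'"
  shows "distr M (K \<Otimes>\<^sub>M K') (\<lambda>\<omega>. (f (U \<omega>), g (V \<omega>)))
       = distr M K (\<lambda>\<omega>. f (U \<omega>)) \<Otimes>\<^sub>M distr M K' (\<lambda>\<omega>. g (V \<omega>))"
proof -
  interpret prob_space M by fact
  have [measurable]: "U \<in> measurable M N" "V \<in> measurable M N'"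
    and ind: "indep_set (sets (vimage_algebra (space M) U N)) (sets (vimage_algebra (space M) V N'))"
    using indep by (auto simp: indep_rvs_def)
  show ?thesis
  proof (rule pair_measure_eqI[symmetric])
    fix A B assume "A \<in> sets (distr M K (\<lambda>\<omega>. f (U \<omega>)))" "B \<in> sets (distr M K' (\<lambda>\<omega>. g (V \<omega>)))"
    then have [measurable]: "A \<in> sets K" "B \<in> sets K'" by simp_all
    define A' where "A' = U -` (f -` A \<inter> space N) \<inter> space M"
    define B' where "B' = V -` (g -` B \<inter> space N') \<inter> space M"
    have "A' \<in> sets (vimage_algebra (space M) U N)" "B' \<in> sets (vimage_algebra (space M) V N')"
      unfolding A'_def B'_def by (intro in_vimage_algebra; measurable)+
    then have eq: "prob (A' \<inter> B') = prob A' * prob B'"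
      by (rule indep_setD[OF ind])
    have A': "(\<lambda>\<omega>. f (U \<omega>)) -` A \<inter> space M = A'"
      using measurable_space[of U M N] by (auto simp: A'_def)
    have B': "(\<lambda>\<omega>. g (V \<omega>)) -` B \<inter> space M = B'"
      using measurable_space[of V M N'] by (auto simp: B'_def)
    have AB': "(\<lambda>\<omega>. (f (U \<omega>), g (V \<omega>))) -` (A \<times> B) \<inter> space M = A' \<inter> B'"
      using A' B' by auto
    show "emeasure (distr M K (\<lambda>\<omega>. f (U \<omega>))) A * emeasure (distr M K' (\<lambda>\<omega>. g (V \<omega>))) B
        = emeasure (distr M (K \<Otimes>\<^sub>M K') (\<lambda>\<omega>. (f (U \<omega>), g (V \<omega>)))) (A \<times> B)"
      by (simp add: emeasure_distr A' B' AB' emeasure_eq_measure eq ennreal_mult)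
  qed (simp_all add: prob_space_distr prob_space_imp_sigma_finite cong: sets_pair_measure_cong)
qed

locale gaussian_regression = prob_space M
  for M :: "'a measure" +
  fixes X :: "nat \<Rightarrow> 'a \<Rightarrow> L2" and \<epsilon> :: "nat \<Rightarrow> 'a \<Rightarrow> real" and \<sigma> :: real
  assumes indep_X: "indep_vars (\<lambda>_. borel) X UNIV"
    and distr_X: "\<And>i. distr M borel (X i) = distr M borel (X 0)"
    and sigma_pos: "\<sigma> > 0"
    and indep_noise: "indep_vars (\<lambda>_. borel) \<epsilon> {1..}"
    and distributed_noise:
      "\<And>i. i \<ge> 1 \<Longrightarrow> distributed M lborel (\<epsilon> i) (\<lambda>u. ennreal (normal_density 0 \<sigma> u))"
    and indep_X_noise: "indep_rvs M
           (Pi\<^sub>M {1..} (\<lambda>_. borel)) (\<lambda>\<omega>. \<lambda>i\<in>{1..}. X i \<omega>)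
           (Pi\<^sub>M {1..} (\<lambda>_. borel)) (\<lambda>\<omega>. \<lambda>i\<in>{1..}. \<epsilon> i \<omega>)"
begin

lemma measurable_X [measurable]: "X i \<in> borel_measurable M"
  using indep_X by (auto simp: indep_vars_def)

lemma measurable_noise: "i \<ge> 1 \<Longrightarrow> \<epsilon> i \<in> borel_measurable M"
  using indep_noise by (auto simp: indep_vars_def)

lemma distr_X_noise:
  assumes "n \<ge> 1"
  shows "distr M (PiM {1..n} (\<lambda>_. borel) \<Otimes>\<^sub>M PiM {1..n} (\<lambda>_. borel))
           (\<lambda>\<omega>. (\<lambda>i\<in>{1..n}. X i \<omega>, \<lambda>i\<in>{1..n}. \<epsilon> i \<omega>))
       = PiM {1..n} (\<lambda>_. distr M borel (X 0)) \<Otimes>\<^sub>M PiM {1..n} (\<lambda>_. gauss \<sigma>)"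
proof -
  have ne: "{1..n} \<noteq> {}" using assms by simp
  have sub: "{1..n} \<inter> {1..} = {1..n}" by auto
  have r: "(\<lambda>f. restrict f {1..n}) \<in> measurable (PiM {1..} (\<lambda>_. N)) (PiM {1..n} (\<lambda>_. N))" for N :: "'c measure"
    by (rule measurable_restrict_subset) auto
  have "distr M (PiM {1..n} (\<lambda>_. borel) \<Otimes>\<^sub>M PiM {1..n} (\<lambda>_. borel))
           (\<lambda>\<omega>. (\<lambda>i\<in>{1..n}. X i \<omega>, \<lambda>i\<in>{1..n}. \<epsilon> i \<omega>))
      = distr M (PiM {1..n} (\<lambda>_. borel)) (\<lambda>\<omega>. \<lambda>i\<in>{1..n}. X i \<omega>)
        \<Otimes>\<^sub>M distr M (PiM {1..n} (\<lambda>_. borel)) (\<lambda>\<omega>. \<lambda>i\<in>{1..n}. \<epsilon> i \<omega>)"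
    using indep_rvs_distr_pair[OF prob_space_axioms indep_X_noise r r]
    by (simp add: restrict_restrict sub Int_commute)
  also have "distr M (PiM {1..n} (\<lambda>_. borel)) (\<lambda>\<omega>. \<lambda>i\<in>{1..n}. X i \<omega>)
      = PiM {1..n} (\<lambda>i. distr M borel (X i))"
    by (rule iffD1[OF indep_vars_iff_distr_eq_PiM'[OF ne] indep_vars_subset[OF indep_X]])
       (auto intro: measurable_noise)
  also have "\<dots> = PiM {1..n} (\<lambda>_. distr M borel (X 0))"
    by (intro PiM_cong refl distr_X)
  also have "distr M (PiM {1..n} (\<lambda>_. borel)) (\<lambda>\<omega>. \<lambda>i\<in>{1..n}. \<epsilon> i \<omega>)
      = PiM {1..n} (\<lambda>i. distr M borel (\<epsilon> i))"
    by (rule iffD1[OF indep_vars_iff_distr_eq_PiM'[OF ne] indep_vars_subset[OF indep_noise]])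
       (auto intro: measurable_noise)
  also have "\<dots> = PiM {1..n} (\<lambda>_. gauss \<sigma>)"
  proof (intro PiM_cong refl)
    fix i assume "i \<in> {1..n}"
    then show "distr M borel (\<epsilon> i) = gauss \<sigma>"
      using distributed_noise[of i] by (simp add: distributed_def cong: distr_cong)
  qed
  finally show ?thesis .
qed

lemma measurable_regression_data [measurable]:
  assumes [measurable]: "g \<in> borel_measurable borel"
  shows "regression_data X \<epsilon> g n \<in> measurable M (PiM {1..n} (\<lambda>_. borel \<Otimes>\<^sub>M borel))"
  unfolding regression_data_def
  by (intro measurable_restrict) (auto intro!: borel_measurable_add measurable_Pair measurable_noise)

lemma distr_regression_data:
  assumes "n \<ge> 1" and g: "g \<in> borel_measurable borel"
  shows "distr M (PiM {1..n} (\<lambda>_. borel \<Otimes>\<^sub>M borel)) (regression_data X \<epsilon> g n)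
       = distr (PiM {1..n} (\<lambda>_. distr M borel (X 0)) \<Otimes>\<^sub>M PiM {1..n} (\<lambda>_. gauss \<sigma>))
           (PiM {1..n} (\<lambda>_. borel \<Otimes>\<^sub>M borel)) (\<lambda>(x, e). \<lambda>i\<in>{1..n}. (x i, g (x i) + e i))"
proof -
  have V: "(\<lambda>\<omega>. (\<lambda>i\<in>{1..n}. X i \<omega>, \<lambda>i\<in>{1..n}. \<epsilon> i \<omega>))
      \<in> measurable M (PiM {1..n} (\<lambda>_. borel) \<Otimes>\<^sub>M PiM {1..n} (\<lambda>_. borel))"
    by (intro measurable_Pair measurable_restrict) (auto intro: measurable_noise)
  have "regression_data X \<epsilon> g n
      = (\<lambda>(x, e). \<lambda>i\<in>{1..n}. (x i, g (x i) + e i)) \<circ> (\<lambda>\<omega>. (\<lambda>i\<in>{1..n}. X i \<omega>, \<lambda>i\<in>{1..n}. \<epsilon> i \<omega>))"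
    by (auto simp: regression_data_def fun_eq_iff)
  then show ?thesis
    unfolding distr_X_noise[OF assms(1), symmetric]
    by (simp only: distr_distr[OF data_measurable[OF g] V])
qed

lemma prob_regression_data_sq_le:
  assumes n: "n \<ge> 1" and s[measurable]: "s \<in> borel_measurable borel"
    and A[measurable]: "A \<in> sets (PiM {1..n} (\<lambda>_. borel \<Otimes>\<^sub>M borel))"
    and b: "(\<integral>\<^sup>+z. ennreal (exp ((s z)\<^sup>2 / \<sigma>\<^sup>2)) \<partial>distr M borel (X 0)) \<le> ennreal b" "b \<ge> 0"
  shows "(prob {\<omega> \<in> space M. regression_data X \<epsilon> s n \<omega> \<in> A})\<^sup>2
       \<le> b ^ n * prob {\<omega> \<in> space M. regression_data X \<epsilon> (\<lambda>_. 0) n \<omega> \<in> A}"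
proof -
  let ?P = "PiM {1..n} (\<lambda>_. borel \<Otimes>\<^sub>M borel) :: (nat \<Rightarrow> L2 \<times> real) measure"
  let ?Q = "\<lambda>g. prob {\<omega> \<in> space M. regression_data X \<epsilon> g n \<omega> \<in> A}"
  have P: "sets (PiM {1..n} (\<lambda>_. distr M borel (X 0) \<Otimes>\<^sub>M borel)) = sets ?P"
    by (intro sets_PiM_cong sets_pair_measure_cong) auto
  have law: "emeasure (distr (PiM {1..n} (\<lambda>_. distr M borel (X 0)) \<Otimes>\<^sub>M PiM {1..n} (\<lambda>_. gauss \<sigma>))
        (PiM {1..n} (\<lambda>_. distr M borel (X 0) \<Otimes>\<^sub>M borel)) (\<lambda>(x, e). \<lambda>i\<in>{1..n}. (x i, g (x i) + e i))) A
      = ennreal (?Q g)" if [measurable]: "g \<in> borel_measurable borel" for g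
  proof -
    have "distr (PiM {1..n} (\<lambda>_. distr M borel (X 0)) \<Otimes>\<^sub>M PiM {1..n} (\<lambda>_. gauss \<sigma>))
        (PiM {1..n} (\<lambda>_. distr M borel (X 0) \<Otimes>\<^sub>M borel)) (\<lambda>(x, e). \<lambda>i\<in>{1..n}. (x i, g (x i) + e i))
      = distr M ?P (regression_data X \<epsilon> g n)"
      unfolding distr_regression_data[OF n that] by (intro distr_cong refl P)
    moreover have "regression_data X \<epsilon> g n -` A \<inter> space M = {\<omega> \<in> space M. regression_data X \<epsilon> g n \<omega> \<in> A}"
      by auto
    ultimately show ?thesis
      by (simp only: emeasure_distr[OF measurable_regression_data[OF that] A] emeasure_eq_measure)
  qed
  have A': "A \<in> sets (PiM {1..n} (\<lambda>_. distr M borel (X 0) \<Otimes>\<^sub>M borel))"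
    using A by (simp only: P)
  have "(ennreal (?Q s))\<^sup>2 \<le> (\<integral>\<^sup>+z. ennreal (exp ((s z)\<^sup>2 / \<sigma>\<^sup>2)) \<partial>distr M borel (X 0)) ^ card {1..n}
      * ennreal (?Q (\<lambda>_. 0))"
    using regression_second_moment_bound[OF prob_space_distr[OF measurable_X] _ sigma_pos _ A', of s] s
    unfolding law[OF s] law[of "\<lambda>_. 0", OF borel_measurable_const] by simp
  then have "ennreal ((?Q s)\<^sup>2) \<le> (\<integral>\<^sup>+z. ennreal (exp ((s z)\<^sup>2 / \<sigma>\<^sup>2)) \<partial>distr M borel (X 0)) ^ n
      * ennreal (?Q (\<lambda>_. 0))"
    by (simp add: ennreal_power)
  also have "\<dots> \<le> ennreal b ^ n * ennreal (?Q (\<lambda>_. 0))"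
    using b by (intro mult_right_mono power_mono) auto
  also have "\<dots> = ennreal (b ^ n * ?Q (\<lambda>_. 0))"
    using b by (simp add: ennreal_power ennreal_mult)
  finally show ?thesis
    using b by (subst (asm) ennreal_le_iff) auto
qed

end

section \<open>The lower bound\<close>

text \<open>
  The quantity bounded by \<open>c\<close> controls the second moment of the likelihood ratio between the zero
  functional and the bump of height \<open>a\<close> on the ball of radius \<open>r\<close>, through
  \<open>(1 + z) ^ n \<le> exp (n * z)\<close>. If the estimator errs by more than \<open>a / 4\<close> with probability below
  \<open>1 / 4\<close> under the bump, it is near \<open>a\<close> with probability at least \<open>3 / 4\<close> there, hence with
  probability at least \<open>exp (- c) / 4\<close> under the zero functional, whose value it then misses.
\<close>

lemma (in gaussian_regression) minimax_lower_bound_finite_sample: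
  fixes x :: L2 and t :: "(nat \<Rightarrow> L2 \<times> real) \<Rightarrow> real"
  assumes n: "n \<ge> 1" and r: "r > 0" and a: "a > 0" "a \<le> C * r powr \<alpha>" and \<alpha>: "\<alpha> > 0"
    and t[measurable]: "t \<in> borel_measurable (PiM {1..n} (\<lambda>_. borel \<Otimes>\<^sub>M borel))"
    and c: "real n * prob {\<omega> \<in> space M. norm (X 0 \<omega> - x) \<le> r} * (exp (a\<^sup>2 / \<sigma>\<^sup>2) - 1) \<le> c"
  shows "\<exists>g\<in>holder_functionals C x \<alpha>.
    prob {\<omega> \<in> space M. \<bar>t (regression_data X \<epsilon> g n \<omega>) - g x\<bar> > a / 4} \<ge> exp (- c) / 4"
proof -
  define s :: "L2 \<Rightarrow> real" where "s = (\<lambda>z. if norm (z - x) \<le> r then a else 0)"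
  define q where "q = prob {\<omega> \<in> space M. norm (X 0 \<omega> - x) \<le> r}"
  define err where "err = (\<lambda>g. prob {\<omega> \<in> space M. \<bar>t (regression_data X \<epsilon> g n \<omega>) - g x\<bar> > a / 4})"
  have "(\<lambda>z. norm (z - x)) \<in> borel_measurable borel"
    by (intro borel_measurable_continuous_onI continuous_intros)
  then have ball[measurable]: "{z. norm (z - x) \<le> r} \<in> sets borel"
    by (simp add: borel_measurable_le)
  have s_ind: "s = (\<lambda>z. a * indicator {z. norm (z - x) \<le> r} z)"
    by (auto simp: s_def fun_eq_iff)
  have s[measurable]: "s \<in> borel_measurable borel"
    unfolding s_ind by measurable
  have C: "C > 0"
    using a r by (smt (verit) mult_nonpos_nonneg powr_ge_zero)
  have s_holder: "s \<in> holder_functionals C x \<alpha>"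
  proof -
    \<comment> \<open>Increments vanish for \<open>\<delta> \<le> r\<close>, since \<open>x + \<delta> *\<^sub>R y\<close> then stays in the ball.\<close>
    have "\<bar>s (x + \<delta> *\<^sub>R y) - s x\<bar> \<le> C * \<delta> powr \<alpha>" if y: "norm y \<le> 1" and \<delta>: "0 \<le> \<delta>" for y \<delta>
    proof (cases "\<delta> \<le> r")
      case True
      with y \<delta> have "\<delta> * norm y \<le> r"
        by (smt (verit) mult_left_le)
      with C r \<delta> show ?thesis by (simp add: s_def)
    next
      case False
      have "\<bar>s (x + \<delta> *\<^sub>R y) - s x\<bar> \<le> a"
        using a(1) by (simp add: s_def)
      also have "a \<le> C * r powr \<alpha>" by fact
      also have "\<dots> \<le> C * \<delta> powr \<alpha>"
        using C r \<alpha> False by (intro mult_left_mono powr_mono2) auto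
      finally show ?thesis .
    qed
    with s show ?thesis by (simp add: holder_functionals_def)
  qed
  have zero_holder: "(\<lambda>_. 0) \<in> holder_functionals C x \<alpha>"
    using C by (simp add: holder_functionals_def)
  define b where "b = 1 + q * (exp (a\<^sup>2 / \<sigma>\<^sup>2) - 1)"
  have q: "q \<ge> 0" by (simp add: q_def)
  have "(\<integral>\<^sup>+z. ennreal (exp ((s z)\<^sup>2 / \<sigma>\<^sup>2)) \<partial>distr M borel (X 0))
      = (\<integral>\<^sup>+z. 1 + ennreal (exp (a\<^sup>2 / \<sigma>\<^sup>2) - 1) * indicator {z. norm (z - x) \<le> r} z \<partial>distr M borel (X 0))"
    using ennreal_plus[of 1 "exp (a\<^sup>2 / \<sigma>\<^sup>2) - 1"]
    by (intro nn_integral_cong) (auto simp: s_def indicator_def)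
  also have "\<dots> = emeasure (distr M borel (X 0)) UNIV
      + ennreal (exp (a\<^sup>2 / \<sigma>\<^sup>2) - 1) * emeasure (distr M borel (X 0)) {z. norm (z - x) \<le> r}"
    by (subst nn_integral_add) (auto simp: nn_integral_cmult_indicator)
  also have "\<dots> = 1 + ennreal (exp (a\<^sup>2 / \<sigma>\<^sup>2) - 1) * ennreal q"
    by (simp add: emeasure_distr emeasure_space_1 emeasure_eq_measure q_def vimage_def Int_def conj_commute prob_space)
  also have "\<dots> = ennreal b"
    using q by (simp add: b_def mult.commute flip: ennreal_mult ennreal_1 ennreal_plus)
  finally have moment: "(\<integral>\<^sup>+z. ennreal (exp ((s z)\<^sup>2 / \<sigma>\<^sup>2)) \<partial>distr M borel (X 0)) = ennreal b" .
  have b0: "b \<ge> 0" using q by (simp add: b_def)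
  have "b ^ n \<le> exp (q * (exp (a\<^sup>2 / \<sigma>\<^sup>2) - 1)) ^ n"
    using b0 exp_ge_add_one_self by (intro power_mono) (auto simp: b_def)
  also have "\<dots> = exp (real n * q * (exp (a\<^sup>2 / \<sigma>\<^sup>2) - 1))"
    by (simp add: exp_of_nat_mult[symmetric] mult.assoc)
  also have "\<dots> \<le> exp c"
    using c by (simp add: q_def)
  finally have bn: "b ^ n \<le> exp c" .
  have "0 \<le> real n * q * (exp (a\<^sup>2 / \<sigma>\<^sup>2) - 1)"
    using q by simp
  then have c0: "c \<ge> 0" using c unfolding q_def by linarith

  \<comment> \<open>The event on which the estimate speaks for the bump.\<close>
  define A where "A = {d \<in> space (PiM {1..n} (\<lambda>_. borel \<Otimes>\<^sub>M borel)). \<bar>t d - a\<bar> \<le> a / 4}"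
  have A: "A \<in> sets (PiM {1..n} (\<lambda>_. borel \<Otimes>\<^sub>M borel))"
    unfolding A_def by measurable
  note D = measurable_space[OF measurable_regression_data]
  have "{\<omega> \<in> space M. regression_data X \<epsilon> s n \<omega> \<in> A}
      = space M - {\<omega> \<in> space M. \<bar>t (regression_data X \<epsilon> s n \<omega>) - s x\<bar> > a / 4}"
    using D[OF s] r by (auto simp: A_def s_def)
  then have PsA: "prob {\<omega> \<in> space M. regression_data X \<epsilon> s n \<omega> \<in> A} = 1 - err s"
    unfolding err_def by (simp add: prob_compl)
  have P0A: "prob {\<omega> \<in> space M. regression_data X \<epsilon> (\<lambda>_. 0) n \<omega> \<in> A} \<le> err (\<lambda>_. 0)"
    unfolding err_def using a(1) by (intro finite_measure_mono) (auto simp: A_def abs_if split: if_splits)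
  have "(1 - err s)\<^sup>2 \<le> b ^ n * prob {\<omega> \<in> space M. regression_data X \<epsilon> (\<lambda>_. 0) n \<omega> \<in> A}"
    using prob_regression_data_sq_le[OF n s A _ b0] moment PsA by simp
  also have "\<dots> \<le> exp c * err (\<lambda>_. 0)"
    using bn P0A by (intro mult_mono) auto
  finally have le: "(1 - err s)\<^sup>2 \<le> exp c * err (\<lambda>_. 0)" .
  show ?thesis
  proof (cases "err s \<ge> 1 / 4")
    case True
    with c0 have "exp (- c) / 4 \<le> err s"
      by (smt (verit) exp_le_one_iff divide_right_mono)
    with s_holder show ?thesis unfolding err_def by blast
  next
    case False
    then have "(1 / 2)\<^sup>2 \<le> (1 - err s)\<^sup>2"
      by (intro power_mono) auto
    with le have "1 / 4 \<le> exp c * err (\<lambda>_. 0)"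
      by (simp add: power2_eq_square)
    then have "exp (- c) / 4 \<le> err (\<lambda>_. 0)"
      by (simp add: exp_minus field_simps)
    with zero_holder show ?thesis unfolding err_def by blast
  qed
qed

lemma exp_minus_one_le: "exp v - 1 \<le> v * exp (v :: real)"
proof -
  have "1 - v \<le> exp (- v)" using exp_ge_add_one_self[of "- v"] by simp
  then have "(1 - v) * exp v \<le> exp (- v) * exp v" by (intro mult_right_mono) auto
  then show ?thesis by (simp add: algebra_simps flip: exp_add)
qed

theorem theorem2:
  fixes M :: "'a measure"
    and X :: "nat \<Rightarrow> 'a \<Rightarrow> L2"  \<comment> \<open>\<open>X 0\<close> is the generic copy, \<open>X 1, X 2, \<dots>\<close> are observed\<close>
    and \<epsilon> :: "nat \<Rightarrow> 'a \<Rightarrow> real"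
    and x :: L2 and h :: "nat \<Rightarrow> real" and \<sigma> \<alpha> c\<^sub>1 :: real
    and T :: "nat \<Rightarrow> (nat \<Rightarrow> L2 \<times> real) \<Rightarrow> real"
  assumes "prob_space M"
    and "prob_space.indep_vars M (\<lambda>_. borel) X UNIV"
    and "\<And>i. distr M borel (X i) = distr M borel (X 0)"
    and "\<sigma> > 0"
    and "prob_space.indep_vars M (\<lambda>_. borel) \<epsilon> {1..}"
    and "\<And>i. i \<ge> 1 \<Longrightarrow> distributed M lborel (\<epsilon> i) (\<lambda>u. ennreal (normal_density 0 \<sigma> u))"
    and "indep_rvs M
           (Pi\<^sub>M {1..} (\<lambda>_. borel)) (\<lambda>\<omega>. \<lambda>i\<in>{1..}. X i \<omega>)
           (Pi\<^sub>M {1..} (\<lambda>_. borel)) (\<lambda>\<omega>. \<lambda>i\<in>{1..}. \<epsilon> i \<omega>)"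
    and "0 < \<alpha>" and "\<alpha> \<le> 1"
    and "\<And>n. h n > 0"
    and "c\<^sub>1 > 0"
    and "filterlim (\<lambda>n. real n * measure M {\<omega> \<in> space M. norm (X 0 \<omega> - x) \<le> c\<^sub>1 * h n})
           at_top sequentially"
    and "(\<lambda>n. h n powr (2 * \<alpha>) * measure M {\<omega> \<in> space M. norm (X 0 \<omega> - x) \<le> c\<^sub>1 * h n})
           \<in> \<Theta>(\<lambda>n. inverse (real n))"
    and "estimator T"
  shows "\<forall>\<^sub>F C in at_top. \<exists>C\<^sub>1>0.
           limsup (\<lambda>n. SUP g \<in> holder_functionals C x \<alpha>.
             ereal (measure M {\<omega> \<in> space M.
               \<bar>T n (regression_data X \<epsilon> g n \<omega>) - g x\<bar> > C\<^sub>1 * h n powr \<alpha>})) > 0"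
proof -
  interpret gaussian_regression M X \<epsilon> \<sigma>
    by (intro gaussian_regression.intro gaussian_regression_axioms.intro) (fact assms)+
  define q where "q n = prob {\<omega> \<in> space M. norm (X 0 \<omega> - x) \<le> c\<^sub>1 * h n}" for n
  have q0: "q n \<ge> 0" for n by (simp add: q_def)
  obtain k where k: "k > 0"
    and bound: "\<forall>\<^sub>F n in sequentially. norm (h n powr (2 * \<alpha>) * q n) \<le> k * norm (inverse (real n))"
    using bigthetaD1[OF assms(13)] unfolding q_def by (elim landau_o.bigE)
  have ev_k: "\<forall>\<^sub>F n in sequentially. h n powr (2 * \<alpha>) * q n \<le> k * inverse (real n)"
    using bound by (rule eventually_mono) (use q0 in \<open>simp add: abs_mult\<close>)
  have ev_1: "\<forall>\<^sub>F n in sequentially. 1 \<le> real n * q n"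
    using assms(12) unfolding q_def filterlim_at_top by blast
  define V where "V = k / \<sigma>\<^sup>2"
  define c where "c = V * exp V"
  have ev_c: "\<forall>\<^sub>F n in sequentially. n \<ge> 1 \<and> real n * q n * (exp ((h n powr \<alpha>)\<^sup>2 / \<sigma>\<^sup>2) - 1) \<le> c"
    using ev_k ev_1
  proof eventually_elim
    case (elim n)
    have n: "n \<ge> 1" using elim(2) by (cases n) auto
    define v where "v = (h n powr \<alpha>)\<^sup>2 / \<sigma>\<^sup>2"
    have sq: "(h n powr \<alpha>)\<^sup>2 = h n powr (2 * \<alpha>)"
      by (simp add: power2_eq_square flip: powr_add)
    have v0: "v \<ge> 0" by (simp add: v_def)
    have "real n * q n * (h n powr \<alpha>)\<^sup>2 \<le> k"
      using elim(1) n by (simp add: sq field_simps)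
    then have nqv: "real n * q n * v \<le> V"
      using sigma_pos by (simp add: v_def V_def divide_right_mono)
    \<comment> \<open>Here the divergence of \<open>n q\<close> enters: it bounds \<open>v\<close> itself, so that \<open>exp v - 1\<close> is of order \<open>v\<close>.\<close>
    have "v \<le> real n * q n * v"
      using elim(2) v0 by (simp add: mult_le_cancel_right1)
    with nqv have "v \<le> V" by simp
    have "real n * q n * (exp v - 1) \<le> real n * q n * (v * exp v)"
      using q0 by (intro mult_left_mono exp_minus_one_le) auto
    also have "\<dots> = (real n * q n * v) * exp v" by simp
    also have "\<dots> \<le> V * exp V"
      using nqv \<open>v \<le> V\<close> v0 by (intro mult_mono) auto
    finally show ?case using n by (simp add: c_def v_def)
  qed
  have "\<exists>C\<^sub>1>0. limsup (\<lambda>n. SUP g \<in> holder_functionals C x \<alpha>.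
             ereal (prob {\<omega> \<in> space M.
               \<bar>T n (regression_data X \<epsilon> g n \<omega>) - g x\<bar> > C\<^sub>1 * h n powr \<alpha>})) > 0"
    if C: "C \<ge> c\<^sub>1 powr (- \<alpha>)" for C
  proof (intro exI conjI)
    let ?S = "\<lambda>n. SUP g \<in> holder_functionals C x \<alpha>. ereal (prob {\<omega> \<in> space M.
               \<bar>T n (regression_data X \<epsilon> g n \<omega>) - g x\<bar> > 1 / 4 * h n powr \<alpha>})"
    have "\<forall>\<^sub>F n in sequentially. ereal (exp (- c) / 4) \<le> ?S n"
      using ev_c
    proof eventually_elim
      case (elim n)
      have "1 * h n powr \<alpha> \<le> (C * c\<^sub>1 powr \<alpha>) * h n powr \<alpha>"
        using C assms(11) by (intro mult_right_mono) (auto simp: powr_minus field_simps)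
      then have "h n powr \<alpha> \<le> C * (c\<^sub>1 * h n) powr \<alpha>"
        using assms(10,11) by (simp add: powr_mult less_imp_le)
      then have "\<exists>g\<in>holder_functionals C x \<alpha>. exp (- c) / 4
          \<le> prob {\<omega> \<in> space M. \<bar>T n (regression_data X \<epsilon> g n \<omega>) - g x\<bar> > h n powr \<alpha> / 4}"
        using elim assms(8,10,11,14)
        by (intro minimax_lower_bound_finite_sample[of n "c\<^sub>1 * h n"])
           (auto simp: estimator_def q_def less_imp_neq[symmetric])
      then show ?case
        by (auto intro: SUP_upper2)
    qed
    then have "ereal (exp (- c) / 4) \<le> limsup ?S"
      by (intro order_trans[OF Liminf_bounded Liminf_le_Limsup]) auto
    moreover have "0 < ereal (exp (- c) / 4)" by simp
    ultimately show "0 < limsup ?S" by (rule less_le_trans[rotated])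
  qed simp
  then show ?thesis
    using eventually_ge_at_top by (rule eventually_mono[rotated])
qed

end
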